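(* Let $\mathcal{A},\mathcal{B},\mathcal{C}$ be the function classes and $D_+,T_0,T_1,T_2,T_L$ the operators defined in the context. Then $T_L$ is a bijection from $\mathcal{A}$ to $\mathcal{C}$. Moreover, $T_L=T_1\circ D_+$ and $T_L^{-1}=T_0\circ T_2$.
   Context: "Decreasing" means non-increasing. Class $\mathcal{A}$ (utility functions): all functions $V$ with domain $[0,\infty)$, which are concave, right continuous at $0$, strictly increasing, and satisfy $V(1)=0$ and $\lim_{x\to\infty}V'_+(x)=0$, where $V'_+$ is the right-hand derivative of $V$ (which may take the value $\infty$ at $x=0$). A function $V$ on $(0,\infty)$ with $\lim_{x\to0^+}V(x)=-\infty$ is extended by $V(0)=-\infty$ and is then said to have domain $[0,\infty)$ and to be right continuous at $0$. Class $\mathcal{B}$ (right-hand derivatives): all functions $f_r$ with domain $[0,\infty)$, which are always greater than $0$, decreasing, right continuous, and satisfy $\lim_{x\to\infty}f_r(x)=0$; if $\lim_{x\to0^+}f_r(x)=\infty$ one sets $f_r(0)=\infty$. Class $\mathcal{C}$ (terminal wealth functions): all functions $f_l$ with domain $[0,\infty)$, which are nonnegative, decreasing, left continuous, and satisfy $\lim_{x\to0^+}f_l(x)=\infty$; one sets $f_l(0)=\infty$. Operators (with $\sup\varnothing=0$): - $D_+:\mathcal{A}\to\mathcal{B}$, $D_+(V)=V'_+$. - $T_0:\mathcal{B}\to\mathcal{A}$, $T_0(f_r)(x)=\int_1^x f_r(t)\,dt$ (the value $-\infty$ is allowed at $x=0$). - $T_1:\mathcal{B}\to\mathcal{C}$,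 $T_1(f_r;y)=\sup\{x\ge0: f_r(x)\ge y\}$, $y\ge 0$. - $T_2:\mathcal{C}\to\mathcal{B}$, $T_2(f_l;y)=\sup\{x\ge0: f_l(x)>y\}$, $y\ge 0$. - $T_L:\mathcal{A}\to\mathcal{C}$, $T_L(V;y)=\sup\{\operatorname{argmax}_{x\ge0}(V(x)-xy)\}$ for $y>0$, and $T_L(V;0)=\infty$.
   Formalization: The class C is taken with the extra condition that f_l(x) tends to 0 as x→∞; without it the claim fails, e.g. f_l(y)=2+1/y is not in the image of T_L and T_2(f_l) is not in B. *)

theory Defs
  imports "HOL-Analysis.Analysis"
begin

text \<open>
  A function with domain \<open>[0,\<infinity>)\<close> is a function of type \<open>real \<Rightarrow> ereal\<close> that is
  extensional on \<open>{0..}\<close>, so that equality of functions is equality on the domain.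
  The values \<open>\<plusminus>\<infinity>\<close> are admitted at the point \<open>0\<close> only.
\<close>

text \<open>The convention is \<open>sup \<emptyset> = 0\<close>, whereas \<^term>\<open>Sup {} :: ereal\<close> is \<open>-\<infinity>\<close>.\<close>

definition sup0 :: "real set \<Rightarrow> ereal" where
  "sup0 S = (if S = {} then 0 else Sup (ereal ` S))"

text \<open>If \<open>V 0 = -\<infinity>\<close>, the difference quotients at \<open>0\<close> are all \<open>\<infinity>\<close>, hence so is the derivative.\<close>

definition right_deriv :: "(real \<Rightarrow> ereal) \<Rightarrow> real \<Rightarrow> ereal" where
  "right_deriv V x = Lim (at_right x) (\<lambda>z. (V z - V x) / ereal (z - x))"

definition class_A :: "(real \<Rightarrow> ereal) set" where
  "class_A = {V \<in> extensional {0..}.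
     (\<forall>x>0. \<bar>V x\<bar> \<noteq> \<infinity>) \<and>
     (\<forall>x\<ge>0. \<forall>z\<ge>0. \<forall>t\<in>{0<..<1}.
        ereal (1 - t) * V x + ereal t * V z \<le> V ((1 - t) * x + t * z)) \<and>
     continuous (at_right 0) V \<and>
     strict_mono_on {0..} V \<and>
     V 1 = 0 \<and>
     (right_deriv V \<longlongrightarrow> 0) at_top}"

definition class_B :: "(real \<Rightarrow> ereal) set" where
  "class_B = {f \<in> extensional {0..}.
     (\<forall>x\<ge>0. 0 < f x) \<and>
     (\<forall>x>0. f x \<noteq> \<infinity>) \<and>
     antimono_on {0..} f \<and>
     (\<forall>x\<ge>0. continuous (at_right x) f) \<and>
     (f \<longlongrightarrow> 0) at_top}"

definition class_C0 :: "(real \<Rightarrow> ereal) set" where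
  "class_C0 = {f \<in> extensional {0..}.
     (\<forall>x\<ge>0. 0 \<le> f x) \<and>
     (\<forall>x>0. f x \<noteq> \<infinity>) \<and>
     antimono_on {0..} f \<and>
     (\<forall>x>0. continuous (at_left x) f) \<and>
     (f \<longlongrightarrow> \<infinity>) (at_right 0) \<and>
     f 0 = \<infinity>}"

text \<open>
  The condition that \<open>f\<close> vanishes at infinity is dual to the finiteness of right-hand
  derivatives on \<open>(0,\<infinity>)\<close>. It cannot be omitted: it is needed for the operator \<open>T_2\<close> below
  to map into \<^const>\<open>class_B\<close>, and for \<open>T_L\<close> to be surjective, see \<open>T_L_not_onto_class_C0\<close>.
\<close>

definition class_C :: "(real \<Rightarrow> ereal) set" where
  "class_C = {f \<in> class_C0. (f \<longlongrightarrow> 0) at_top}"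

definition D_plus :: "(real \<Rightarrow> ereal) \<Rightarrow> real \<Rightarrow> ereal" where
  "D_plus V = (\<lambda>x\<in>{0..}. right_deriv V x)"

text \<open>
  The integral from \<open>1\<close> to \<open>x\<close> of a nonnegative extended function, for \<open>x < 1\<close> minus the
  integral from \<open>x\<close> to \<open>1\<close>; the latter may diverge for \<open>x = 0\<close>, where the Bochner integral
  would return \<open>0\<close> instead of \<open>-\<infinity>\<close>.
\<close>

definition T_0 :: "(real \<Rightarrow> ereal) \<Rightarrow> real \<Rightarrow> ereal" where
  "T_0 f = (\<lambda>x\<in>{0..}.
     if 1 \<le> x then enn2ereal (\<integral>\<^sup>+t\<in>{1..x}. e2ennreal (f t) \<partial>lborel)
     else - enn2ereal (\<integral>\<^sup>+t\<in>{x..1}. e2ennreal (f t) \<partial>lborel))"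

definition T_1 :: "(real \<Rightarrow> ereal) \<Rightarrow> real \<Rightarrow> ereal" where
  "T_1 f = (\<lambda>y\<in>{0..}. sup0 {x. 0 \<le> x \<and> ereal y \<le> f x})"

definition T_2 :: "(real \<Rightarrow> ereal) \<Rightarrow> real \<Rightarrow> ereal" where
  "T_2 f = (\<lambda>y\<in>{0..}. sup0 {x. 0 \<le> x \<and> ereal y < f x})"

definition T_L :: "(real \<Rightarrow> ereal) \<Rightarrow> real \<Rightarrow> ereal" where
  "T_L V = (\<lambda>y\<in>{0..}.
     if y = 0 then \<infinity>
     else sup0 {x. is_arg_max (\<lambda>x. V x - ereal (x * y)) (\<lambda>x. 0 \<le> x) x})"

lemma T_L_not_onto_class_C0:
  defines "f \<equiv> (\<lambda>x\<in>{0..}. if x = 0 then \<infinity> else ereal (2 + 1 / x))"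
  shows "f \<in> class_C0" and "f \<notin> T_L ` class_A"
proof -
  have lc: "continuous (at_left x) f" if "x > 0" for x :: real
  proof -
    have "((\<lambda>x. ereal (2 + 1 / x)) \<longlongrightarrow> ereal (2 + 1 / x)) (at_left x)"
      using that by (intro tendsto_intros) auto
    moreover have "\<forall>\<^sub>F z in at_left x. ereal (2 + 1 / z) = f z"
      using eventually_at_left_real[OF that] by eventually_elim (auto simp: f_def)
    ultimately have "(f \<longlongrightarrow> ereal (2 + 1 / x)) (at_left x)"
      by (rule Lim_transform_eventually)
    also have "ereal (2 + 1 / x) = f x"
      using that by (simp add: f_def)
    finally show ?thesis by (simp add: continuous_within)
  qed
  have lim: "(f \<longlongrightarrow> \<infinity>) (at_right 0)"
  proof -
    have "filterlim (\<lambda>x::real. 2 + 1 / x) at_top (at_right 0)"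
      by (intro filterlim_tendsto_add_at_top[OF tendsto_const])
        (use filterlim_inverse_at_top_right in \<open>simp add: inverse_eq_divide\<close>)
    then have "((\<lambda>x. ereal (2 + 1 / x)) \<longlongrightarrow> \<infinity>) (at_right 0)"
      by (simp add: tendsto_PInfty_eq_at_top)
    moreover have "\<forall>\<^sub>F z in at_right 0. ereal (2 + 1 / z) = f z"
      using eventually_at_right_less[of 0] by eventually_elim (auto simp: f_def)
    ultimately show ?thesis by (rule Lim_transform_eventually)
  qed
  have "antimono_on {0..} f"
    by (auto simp: monotone_on_def f_def frac_le)
  with lc lim show "f \<in> class_C0"
    by (auto simp: class_C0_def f_def)
  show "f \<notin> T_L ` class_A"
  proof
    assume "f \<in> T_L ` class_A"
    then obtain V where V: "V \<in> class_A" and f: "f = T_L V" by auto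
    have fin: "\<bar>V x\<bar> \<noteq> \<infinity>" if "x > 0" for x
      using V that by (auto simp: class_A_def)
    have V1: "V 1 = 0" using V by (simp add: class_A_def)
    have "strict_mono_on {0..} V" using V by (simp add: class_A_def)
    then have "V 1 < V 2" by (rule strict_mono_onD) auto
    obtain v where v: "V 2 = ereal v" using fin[of 2] by auto
    define y where "y = v + 1"
    have "v > 0" using V1 \<open>V 1 < V 2\<close> v by simp
    then have y: "y > 0" by (simp add: y_def)
    define S where "S = {x. is_arg_max (\<lambda>x. V x - ereal (x * y)) (\<lambda>x. 0 \<le> x) x}"
    have "sup0 S = ereal (2 + 1 / y)"
      using fun_cong[OF f, of y] y by (simp add: f_def T_L_def S_def)
    then have "2 < sup0 S" using y by simp
    then obtain x where x: "x \<in> S" "2 < x"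
      by (auto simp: sup0_def less_Sup_iff split: if_splits)
    obtain w where w: "V x = ereal w" using fin[of x] x by auto
    have "\<forall>z\<ge>0. \<not> V x - ereal (x * y) < V z - ereal (z * y)"
      using x(1) unfolding S_def is_arg_max_def by blast
    then have "\<not> V x - ereal (x * y) < V 1 - ereal (1 * y)"
      using zero_le_one by blast
    then have 1: "w \<ge> (x - 1) * y"
      using w V1 by (simp add: zero_ereal_def algebra_simps)
    have "\<forall>x\<ge>0. \<forall>z\<ge>0. \<forall>t\<in>{0<..<1}.
        ereal (1 - t) * V x + ereal t * V z \<le> V ((1 - t) * x + t * z)"
      using V by (simp add: class_A_def)
    from this[rule_format, of 1 x "1 / (x - 1)"]
    have "ereal (1 / (x - 1)) * V x \<le> V ((1 - 1 / (x - 1)) * 1 + 1 / (x - 1) * x)"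
      using x(2) by (simp add: V1)
    also have "(1 - 1 / (x - 1)) * 1 + 1 / (x - 1) * x = 2"
    proof -
      have "(1 - 1 / (x - 1)) * 1 + 1 / (x - 1) * x = 1 + 1 / (x - 1) * (x - 1)"
        by (simp only: right_diff_distrib) simp
      then show ?thesis using x(2) by simp
    qed
    finally have "w / (x - 1) \<le> v" by (simp add: v w)
    moreover have "y \<le> w / (x - 1)"
      using 1 x(2) by (simp add: pos_le_divide_eq mult.commute)
    ultimately have "y \<le> v" by simp
    then show False by (simp add: y_def)
  qed
qed

end

theory Submission
  imports Defs
begin

text \<open>
  Everything factors through the right-hand derivative \<open>f = V'\<^sub>+\<close>. Between \<open>V\<close> and \<open>f\<close> the link
  is the secant inequality \<open>f z \<le> (V z - V x) / (z - x) \<le> f x\<close> for \<open>0 \<le> x < z\<close>: concavity of \<open>V\<close>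
  yields it for \<open>f = V'\<^sub>+\<close>, monotonicity of the integral yields it for \<open>V = T_0 f\<close>, and for
  \<open>f \<in> \<B>\<close> it conversely forces \<open>V\<close> to be concave with \<open>V'\<^sub>+ = f\<close>. It also determines the increments
  of \<open>V\<close>, because the upper and lower Darboux sums of \<open>f\<close> squeeze them; so \<open>D_+\<close> and \<open>T_0\<close> are
  mutually inverse. The operators \<open>T_1\<close> and \<open>T_2\<close> are generalized inverses of decreasing functions,
  and they undo each other because of one-sided continuity. Finally, \<open>V x - x y\<close> is increasing where
  \<open>V'\<^sub>+ \<ge> y\<close> and strictly decreasing where \<open>V'\<^sub>+ < y\<close>, so its last maximizer is \<open>T_1 V'\<^sub>+\<close> at \<open>y\<close>.
\<close>

section \<open>Generalized inverses of decreasing functions\<close>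

text \<open>For nonnegative \<open>c\<close> the convention for the empty set does no harm: if
  \<open>S\<close> is empty, both sides are false.\<close>

lemma less_sup0_iff:
  assumes "0 \<le> c" shows "c < sup0 S \<longleftrightarrow> (\<exists>x\<in>S. c < ereal x)"
  using assms by (auto simp: sup0_def less_Sup_iff)

text \<open>The conjunct \<open>0 \<le> c\<close> accounts for empty \<open>S\<close>, where the
  supremum is \<open>0\<close>; for nonempty \<open>S\<close> it follows from the nonnegativity of
  the elements.\<close>

lemma sup0_le_iff:
  assumes "\<And>x. x \<in> S \<Longrightarrow> 0 \<le> x" shows "sup0 S \<le> c \<longleftrightarrow> 0 \<le> c \<and> (\<forall>x\<in>S. ereal x \<le> c)"
proof (cases "S = {}")
  case False
  then obtain x where x: "x \<in> S" by auto
  have "0 \<le> c" if "\<forall>x\<in>S. ereal x \<le> c"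
    using that x assms[OF x] by (metis ereal_less_eq(5) order_trans)
  then show ?thesis using False by (auto simp: sup0_def Sup_le_iff)
qed (auto simp: sup0_def)

text \<open>This and the next three equivalences replace the suprema by statements about single
  points. Taking the value of the operator itself for \<open>c\<close> gives its upper bound
  property.\<close>

lemma T_1_le_iff:
  assumes "0 \<le> y"
  shows "T_1 f y \<le> c \<longleftrightarrow> 0 \<le> c \<and> (\<forall>x\<ge>0. ereal y \<le> f x \<longrightarrow> ereal x \<le> c)"
  using assms unfolding T_1_def restrict_apply by (subst if_P, simp, subst sup0_le_iff) auto

lemma less_T_1_iff:
  assumes "0 \<le> y" "0 \<le> c"
  shows "c < T_1 f y \<longleftrightarrow> (\<exists>x\<ge>0. ereal y \<le> f x \<and> c < ereal x)"
  using assms by (auto simp add: T_1_def less_sup0_iff)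

lemma T_2_le_iff:
  assumes "0 \<le> y"
  shows "T_2 f y \<le> c \<longleftrightarrow> 0 \<le> c \<and> (\<forall>x\<ge>0. ereal y < f x \<longrightarrow> ereal x \<le> c)"
  using assms unfolding T_2_def restrict_apply by (subst if_P, simp, subst sup0_le_iff) auto

lemma less_T_2_iff:
  assumes "0 \<le> y" "0 \<le> c"
  shows "c < T_2 f y \<longleftrightarrow> (\<exists>x\<ge>0. ereal y < f x \<and> c < ereal x)"
  using assms by (auto simp add: T_2_def less_sup0_iff)

lemma T_1_nonneg: "0 \<le> y \<Longrightarrow> 0 \<le> T_1 f y"
  using T_1_le_iff[of y f "T_1 f y"] by simp

lemma T_2_nonneg: "0 \<le> y \<Longrightarrow> 0 \<le> T_2 f y"
  using T_2_le_iff[of y f "T_2 f y"] by simp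

lemma T_1_antimono: "0 \<le> y \<Longrightarrow> y \<le> y' \<Longrightarrow> T_1 f y' \<le> T_1 f y"
proof -
  assume *: "0 \<le> y" "y \<le> y'"
  have "\<forall>x\<ge>0. ereal y \<le> f x \<longrightarrow> ereal x \<le> T_1 f y"
    using T_1_le_iff[of y f "T_1 f y"] * by simp
  then show "T_1 f y' \<le> T_1 f y"
    using * T_1_nonneg[of y f] by (subst T_1_le_iff) (auto, meson ereal_less_eq(3) order_trans)
qed

lemma T_2_antimono: "0 \<le> y \<Longrightarrow> y \<le> y' \<Longrightarrow> T_2 f y' \<le> T_2 f y"
proof -
  assume *: "0 \<le> y" "y \<le> y'"
  have "\<forall>x\<ge>0. ereal y < f x \<longrightarrow> ereal x \<le> T_2 f y"
    using T_2_le_iff[of y f "T_2 f y"] * by simp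
  then show "T_2 f y' \<le> T_2 f y"
    using * T_2_nonneg[of y f] by (subst T_2_le_iff) (auto, meson ereal_less_eq(3) le_less_trans)
qed

section \<open>Mapping properties and mutual inversion of \<open>T_1\<close> and
  \<open>T_2\<close>\<close>

lemma ereal_pos_between:
  assumes "0 < a" obtains c where "0 < c" "ereal c < a"
  using ereal_dense2[OF assms] by auto

text \<open>One half of left continuity is free for a decreasing function, since its values to the
  left of \<open>x\<close> are at least \<open>f x\<close>. The next lemma is the mirror image for
  right continuity.\<close>

lemma antimono_on_eventually_at_left:
  fixes f :: "real \<Rightarrow> ereal"
  assumes "antimono_on {0..} f" "0 < x" "a < f x"
  shows "\<forall>\<^sub>F z in at_left x. a < f z"
  using eventually_at_left_real[OF assms(2)]
  by eventually_elim (use assms in \<open>auto simp: monotone_on_def intro!: less_le_trans[OF assms(3)]\<close>)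

lemma antimono_on_eventually_at_right:
  fixes f :: "real \<Rightarrow> ereal"
  assumes "antimono_on {0..} f" "0 \<le> x" "f x < a"
  shows "\<forall>\<^sub>F z in at_right x. f z < a"
  using eventually_at_right_less[of x]
  by eventually_elim (use assms in \<open>auto simp: monotone_on_def intro!: le_less_trans[OF _ assms(3)]\<close>)

text \<open>Inversion swaps the two axes and with them the boundary conditions: positivity of
  \<open>f\<close> makes \<open>T_1 f\<close> blow up at \<open>0\<close>, decay of \<open>f\<close>
  makes it finite, and finiteness of \<open>f\<close> makes it decay. The non-strict inequality in
  \<open>T_1\<close> is what yields left continuity.\<close>

lemma T_1_in_class_C:
  assumes f: "f \<in> class_B" shows "T_1 f \<in> class_C"
proof -
  have pos: "\<And>x. 0 \<le> x \<Longrightarrow> 0 < f x" and fin: "\<And>x. 0 < x \<Longrightarrow> f x \<noteq> \<infinity>"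
    and mono: "\<And>x z. 0 \<le> x \<Longrightarrow> x \<le> z \<Longrightarrow> f z \<le> f x"
    and lim: "(f \<longlongrightarrow> 0) at_top"
    using f by (auto simp: class_B_def monotone_on_def)
  have anti: "antimono_on {0..} (T_1 f)"
    by (auto simp: monotone_on_def intro: T_1_antimono)
  have unbounded: "\<forall>\<^sub>F y in at_right 0. ereal r < T_1 f y" for r
  proof -
    \<comment> \<open>A point beyond \<open>r\<close>. As \<open>f x\<close> is positive, every
      small \<open>y\<close> lies below it, and then \<open>x\<close> witnesses that
      \<open>T_1 f y\<close> exceeds \<open>r\<close>.\<close>
    define x where "x = \<bar>r\<bar> + 1"
    obtain b where b: "0 < b" "ereal b < f x"
      using ereal_pos_between[OF pos[of x]] by (auto simp: x_def)
    show ?thesis using eventually_at_right_real[OF b(1)]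
    proof eventually_elim
      case (elim y)
      \<comment> \<open>\<open>less_T_1_iff\<close> asks for a nonnegative bound, hence the absolute
        value.\<close>
      then have "ereal \<bar>r\<bar> < T_1 f y"
        using b by (subst less_T_1_iff) (auto intro!: exI[of _ x] less_imp_le le_less_trans[OF _ b(2)], auto simp: x_def)
      then show ?case by (rule le_less_trans[rotated]) simp
    qed
  qed
  have "T_1 f y \<noteq> \<infinity>" if "0 < y" for y
  proof -
    have "\<forall>\<^sub>F x in at_top. f x < ereal y"
      using that by (intro order_tendstoD[OF lim]) auto
    then obtain X where X: "\<And>x. X \<le> x \<Longrightarrow> f x < ereal y"
      by (auto simp: eventually_at_top_linorder)
    have "T_1 f y \<le> ereal \<bar>X\<bar>"
      using that X by (subst T_1_le_iff) (auto simp: not_less[symmetric] intro!: leI)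
    then show ?thesis by auto
  qed
  moreover have "continuous (at_left y) (T_1 f)" if y: "0 < y" for y
    unfolding continuous_within
  proof (rule order_tendstoI)
    fix a assume "a < T_1 f y"
    then show "\<forall>\<^sub>F z in at_left y. a < T_1 f z"
      using antimono_on_eventually_at_left[OF anti y] by blast
  next
    fix a assume a: "T_1 f y < a"
    then obtain c where c: "T_1 f y < ereal c" "ereal c < a"
      using ereal_dense2 by blast
    have "0 < ereal c" using T_1_nonneg[of y f] y c by (metis less_imp_le order_le_less_trans)
    then have c0: "0 < c" by simp
    have "f c < ereal y"
    proof (rule ccontr)
      assume "\<not> f c < ereal y"
      then have "ereal c \<le> T_1 f y"
        using T_1_le_iff[of y f "T_1 f y"] y c0 by simp
      with c show False by simp
    qed
    \<comment> \<open>The gap between \<open>f c\<close> and \<open>y\<close> leaves room to lower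
      \<open>y\<close>: for \<open>z\<close> in it, \<open>z \<le> f x\<close> forces
      \<open>x \<le> c\<close>, so \<open>T_1 f z\<close> stays below \<open>a\<close>.\<close>
    then obtain b where b: "f c < ereal b" "ereal b < ereal y"
      using ereal_dense2 by blast
    have "0 < ereal b" using pos[of c] b c0 by (metis less_imp_le order.strict_trans)
    then have b0: "0 < b" by simp
    have "b < y" using b by simp
    from eventually_at_left_real[OF this] show "\<forall>\<^sub>F z in at_left y. T_1 f z < a"
    proof eventually_elim
      case (elim z)
      have "T_1 f z \<le> ereal c"
      proof (subst T_1_le_iff, use b0 elim c0 in simp, intro conjI allI impI)
        fix x assume x: "0 \<le> x" "ereal z \<le> f x"
        show "ereal x \<le> ereal c"
        proof (rule ccontr)
          assume "\<not> ereal x \<le> ereal c"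
          then have "f x \<le> f c" using c0 by (intro mono) auto
          with x b have "ereal z < ereal b" by order
          with elim show False by simp
        qed
      qed (use c0 in auto)
      then show ?case using c by order
    qed
  qed
  moreover have "(T_1 f \<longlongrightarrow> \<infinity>) (at_right 0)"
    using unbounded by (simp add: tendsto_PInfty)
  moreover have "T_1 f 0 = \<infinity>"
  proof -
    have "ereal r < T_1 f 0" for r
    proof -
      have "ereal \<bar>r\<bar> < T_1 f 0"
        by (subst less_T_1_iff) (auto intro!: exI[of _ "\<bar>r\<bar> + 1"] less_imp_le pos simp: zero_ereal_def[symmetric])
      then show ?thesis by (rule le_less_trans[rotated]) simp
    qed
    then show ?thesis by (metis ereal_top less_imp_le)
  qed
  moreover have "(T_1 f \<longlongrightarrow> 0) at_top"
  proof (rule order_tendstoI)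
    fix a :: ereal assume a: "a < 0"
    show "\<forall>\<^sub>F z in at_top. a < T_1 f z"
      using eventually_ge_at_top[of 0]
      by eventually_elim (auto intro!: less_le_trans[OF a] T_1_nonneg)
  next
    fix a :: ereal assume "0 < a"
    then obtain c where c: "0 < c" "ereal c < a" by (rule ereal_pos_between)
    \<comment> \<open>Once \<open>z\<close> exceeds the finite value \<open>f c\<close>, no point
      beyond \<open>c\<close> has \<open>f x \<ge> z\<close>.\<close>
    obtain r where r: "f c = ereal r" using fin[OF c(1)] pos[of c] c(1) by (cases "f c") auto
    show "\<forall>\<^sub>F z in at_top. T_1 f z < a"
      using eventually_gt_at_top[of "\<bar>r\<bar>"]
    proof eventually_elim
      case (elim z)
      have "T_1 f z \<le> ereal c"
      proof (subst T_1_le_iff, use elim in simp, intro conjI allI impI)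
        fix x assume x: "0 \<le> x" "ereal z \<le> f x"
        show "ereal x \<le> ereal c"
        proof (rule ccontr)
          assume "\<not> ereal x \<le> ereal c"
          then have "f x \<le> f c" using c by (intro mono) auto
          with x r have "ereal z \<le> ereal r" by order
          with elim show False by simp
        qed
      qed (use c in auto)
      then show ?case using c by order
    qed
  qed
  ultimately show ?thesis using anti T_1_nonneg
    by (auto simp: class_C_def class_C0_def, simp add: T_1_def)
qed

text \<open>Dual to \<open>T_1_in_class_C\<close>. Now the blow-up of \<open>g\<close> at
  \<open>0\<close> gives positivity, and the strict inequality in \<open>T_2\<close> gives right
  continuity: if \<open>y < g x\<close>, then \<open>y\<close> can be raised a little while keeping
  the witness \<open>x\<close>.\<close>

lemma T_2_in_class_B:
  assumes g: "g \<in> class_C" shows "T_2 g \<in> class_B"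
proof -
  have fin: "\<And>x. 0 < x \<Longrightarrow> g x \<noteq> \<infinity>" and nn: "\<And>x. 0 \<le> x \<Longrightarrow> 0 \<le> g x"
    and mono: "\<And>x z. 0 \<le> x \<Longrightarrow> x \<le> z \<Longrightarrow> g z \<le> g x"
    and lim0: "(g \<longlongrightarrow> \<infinity>) (at_right 0)" and lim: "(g \<longlongrightarrow> 0) at_top"
    using g by (auto simp: class_C_def class_C0_def monotone_on_def)
  have anti: "antimono_on {0..} (T_2 g)"
    by (auto simp: monotone_on_def intro: T_2_antimono)
  have "0 < T_2 g y" if "0 \<le> y" for y
  proof -
    have "\<forall>\<^sub>F x in at_right 0. ereal y < g x"
      using lim0 by (simp add: tendsto_PInfty)
    then have "\<forall>\<^sub>F x in at_right 0. ereal y < g x \<and> 0 < x"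
      using eventually_at_right_less[of 0] by eventually_elim auto
    then obtain x where "ereal y < g x" "0 < x"
      using eventually_happens'[OF trivial_limit_at_right_real] by blast
    then show ?thesis using that by (subst less_T_2_iff) (auto intro!: exI[of _ x])
  qed
  moreover have "T_2 g y \<noteq> \<infinity>" if "0 < y" for y
  proof -
    have "\<forall>\<^sub>F x in at_top. g x < ereal y"
      using that by (intro order_tendstoD[OF lim]) auto
    then obtain X where X: "\<And>x. X \<le> x \<Longrightarrow> g x < ereal y"
      by (auto simp: eventually_at_top_linorder)
    have "T_2 g y \<le> ereal \<bar>X\<bar>"
      using that by (subst T_2_le_iff) (auto, metis X abs_ge_self linear not_less order_trans less_imp_le)
    then show ?thesis by auto
  qed
  moreover have "continuous (at_right y) (T_2 g)" if y: "0 \<le> y" for y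
    unfolding continuous_within
  proof (rule order_tendstoI)
    fix a assume "T_2 g y < a"
    then show "\<forall>\<^sub>F z in at_right y. T_2 g z < a"
      using antimono_on_eventually_at_right[OF anti y] by blast
  next
    fix a assume a: "a < T_2 g y"
    show "\<forall>\<^sub>F z in at_right y. a < T_2 g z"
    proof (cases "0 \<le> a")
      case True
      then obtain x where x: "0 \<le> x" "ereal y < g x" "a < ereal x"
        using a y by (auto simp: less_T_2_iff)
      then obtain b where b: "ereal y < ereal b" "ereal b < g x"
        using ereal_dense2 by blast
      then have "y < b" by simp
      from eventually_at_right_real[OF this] show ?thesis
      proof eventually_elim
        case (elim z)
        then have "ereal z < g x" using b by (auto intro: less_trans[OF _ b(2)])
        then show ?case using elim x y True by (subst less_T_2_iff) auto
      qed
    next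
      case False
      then have a: "a < 0" by simp
      show ?thesis using eventually_at_right_less[of y]
        by eventually_elim (use y in \<open>auto intro!: less_le_trans[OF a T_2_nonneg]\<close>)
    qed
  qed
  moreover have "(T_2 g \<longlongrightarrow> 0) at_top"
  proof (rule order_tendstoI)
    fix a :: ereal assume a: "a < 0"
    show "\<forall>\<^sub>F z in at_top. a < T_2 g z"
      using eventually_ge_at_top[of 0]
      by eventually_elim (auto intro!: less_le_trans[OF a] T_2_nonneg)
  next
    fix a :: ereal assume "0 < a"
    then obtain c where c: "0 < c" "ereal c < a" by (rule ereal_pos_between)
    obtain r where r: "g c = ereal r" using fin[OF c(1)] nn[of c] c(1) by (cases "g c") auto
    show "\<forall>\<^sub>F z in at_top. T_2 g z < a"
      using eventually_gt_at_top[of "\<bar>r\<bar>"]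
    proof eventually_elim
      case (elim z)
      have "T_2 g z \<le> ereal c"
      proof (subst T_2_le_iff, use elim in simp, intro conjI allI impI)
        fix x assume x: "0 \<le> x" "ereal z < g x"
        show "ereal x \<le> ereal c"
        proof (rule ccontr)
          assume "\<not> ereal x \<le> ereal c"
          then have "g x \<le> g c" using c by (intro mono) auto
          with x r have "ereal z < ereal r" by (metis less_le_trans)
          with elim show False by simp
        qed
      qed (use c in auto)
      then show ?case using c by order
    qed
  qed
  ultimately show ?thesis using anti
    by (auto simp: class_B_def, simp add: T_2_def)
qed

text \<open>If \<open>x < T_1 f y\<close>, some \<open>z > x\<close> has \<open>f z \<ge> y\<close>,
  so \<open>f x \<ge> y\<close> by monotonicity. Conversely, right continuity supplies for each
  \<open>b < f x\<close> a point \<open>z > x\<close> with \<open>f z > b\<close>, and this puts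
  \<open>T_1 f b\<close> strictly above \<open>x\<close>.\<close>

lemma T_2_T_1:
  assumes f: "f \<in> class_B" shows "T_2 (T_1 f) = f"
proof
  fix x
  have pos: "\<And>x. 0 \<le> x \<Longrightarrow> 0 < f x" 
    and mono: "\<And>x z. 0 \<le> x \<Longrightarrow> x \<le> z \<Longrightarrow> f z \<le> f x"
    and cont: "\<And>x. 0 \<le> x \<Longrightarrow> (f \<longlongrightarrow> f x) (at_right x)" and ext: "f \<in> extensional {0..}"
    using f by (auto simp: class_B_def monotone_on_def continuous_within)
  show "T_2 (T_1 f) x = f x"
  proof (cases "0 \<le> x")
    case x: True
    show ?thesis
    proof (rule antisym)
      have "ereal y \<le> f x" if y: "0 \<le> y" "ereal x < T_1 f y" for y
      proof -
        obtain z where "0 \<le> z" "ereal y \<le> f z" "ereal x < ereal z"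
          using y x by (auto simp: less_T_1_iff)
        then show ?thesis using mono[of x z] x by (auto intro: order_trans)
      qed
      then show "T_2 (T_1 f) x \<le> f x"
        using pos[OF x] x by (subst T_2_le_iff) auto
    next
      show "f x \<le> T_2 (T_1 f) x"
      proof (rule dense_le)
        fix a assume a: "a < f x"
        show "a \<le> T_2 (T_1 f) x"
        proof (cases "0 \<le> a")
          case True
          \<comment> \<open>Approximation from below by real levels also covers
            \<open>f 0 = \<infinity>\<close>.\<close>
          from ereal_dense2[OF a] obtain b where b: "a < ereal b" "ereal b < f x" by auto
          have "\<forall>\<^sub>F z in at_right x. ereal b < f z \<and> x < z"
            using order_tendstoD(1)[OF cont[OF x] b(2)] eventually_at_right_less[of x]
            by eventually_elim auto
          then obtain z where z: "ereal b < f z" "x < z"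
            using eventually_happens'[OF trivial_limit_at_right_real] by blast
          have "0 \<le> ereal b" using True b by order
          then have b0: "0 \<le> b" by simp
          then have "ereal x < T_1 f b"
            using x z by (subst less_T_1_iff) (auto intro!: exI[of _ z])
          then have "a < T_2 (T_1 f) x"
            using b0 b x True by (subst less_T_2_iff) auto
          then show ?thesis by simp
        next
          case False
          then show ?thesis using T_2_nonneg[OF x, of "T_1 f"] by (meson linear order_trans)
        qed
      qed
    qed
  next
    case False
    then show ?thesis using ext by (auto simp: T_2_def extensional_def)
  qed
qed

text \<open>Here left continuity is what closes the gap: \<open>y \<le> T_2 g x\<close> only
  controls \<open>g\<close> at points \<open>z < y\<close>, and the bound \<open>x \<le> g z\<close>
  has to pass to the limit. The other inequality is immediate, because \<open>b < g y\<close> makes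
  \<open>y\<close> itself a witness for \<open>T_2 g b\<close>.\<close>

lemma T_1_T_2:
  assumes g: "g \<in> class_C" shows "T_1 (T_2 g) = g"
proof
  fix y :: real
  have nn: "\<And>x. 0 \<le> x \<Longrightarrow> 0 \<le> g x"
    and mono: "\<And>x z. 0 \<le> x \<Longrightarrow> x \<le> z \<Longrightarrow> g z \<le> g x"
    and cont: "\<And>x. 0 < x \<Longrightarrow> (g \<longlongrightarrow> g x) (at_left x)"
    and ext: "g \<in> extensional {0..}" and g0: "g 0 = \<infinity>"
    using g by (auto simp: class_C_def class_C0_def monotone_on_def continuous_within)
  consider "y < 0" | "y = 0" | "0 < y" by linarith
  then show "T_1 (T_2 g) y = g y"
  proof cases
    case 1
    then show ?thesis using ext by (auto simp: T_1_def extensional_def)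
  next
    case 2
    \<comment> \<open>At \<open>0\<close> every member of the class has the prescribed value
      infinity.\<close>
    have "T_1 (T_2 g) \<in> class_C"
      using g T_1_in_class_C T_2_in_class_B by blast
    then show ?thesis using 2 g0 by (simp add: class_C_def class_C0_def)
  next
    case y: 3
    show ?thesis
    proof (rule antisym)
      have "ereal x \<le> g y" if x: "0 \<le> x" "ereal y \<le> T_2 g x" for x
      proof (rule tendsto_lowerbound[OF cont[OF y]])
        show "\<forall>\<^sub>F z in at_left y. ereal x \<le> g z"
          using eventually_at_left_real[OF y]
        proof eventually_elim
          case (elim z)
          then have "ereal z < T_2 g x" using x by (auto intro: less_le_trans[OF _ x(2)])
          then obtain w where w: "0 \<le> w" "ereal x < g w" "ereal z < ereal w"
            using elim x by (auto simp: less_T_2_iff)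
          then show ?case using mono[of z w] elim by auto
        qed
      qed simp
      then show "T_1 (T_2 g) y \<le> g y"
        using y nn by (subst T_1_le_iff) auto
    next
      show "g y \<le> T_1 (T_2 g) y"
      proof (rule dense_le)
        fix a assume a: "a < g y"
        show "a \<le> T_1 (T_2 g) y"
        proof (cases "0 \<le> a")
          case True
          from ereal_dense2[OF a] obtain b where b: "a < ereal b" "ereal b < g y" by auto
          have "0 \<le> ereal b" using True b by order
          then have b0: "0 \<le> b" by simp
          then have "ereal y \<le> T_2 g b"
            using T_2_le_iff[of b g "T_2 g b"] b y by auto
          then have "a < T_1 (T_2 g) y"
            using b0 b y True by (subst less_T_1_iff) auto
          then show ?thesis by simp
        next
          case False
          then show ?thesis using T_1_nonneg[of y "T_2 g"] y by (meson linear order_trans less_imp_le)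
        qed
      qed
    qed
  qed
qed

section \<open>Secants of concave functions\<close>

text \<open>Extended values let \<open>V 0 = -\<infinity>\<close> join the general case: slopes from
  \<open>0\<close> to a point with finite value are then infinite.\<close>

definition slope :: "(real \<Rightarrow> ereal) \<Rightarrow> real \<Rightarrow> real \<Rightarrow> ereal" where
  "slope V x z = (V z - V x) / ereal (z - x)"

lemma class_A_cases:
  assumes V: "V \<in> class_A" and x: "0 \<le> x"
  obtains (real) r where "V x = ereal r" | (MInf) "x = 0" "V x = -\<infinity>"
proof (cases "x = 0")
  case True
  have "strict_mono_on {0..} V" using V by (simp add: class_A_def)
  \<comment> \<open>This excludes the value infinity at \<open>0\<close>, about which the finiteness
    clause of \<open>class_A\<close> is silent.\<close>
  then have "V 0 < V 1" by (rule strict_mono_onD) auto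
  then have "V 0 < 0" using V by (simp add: class_A_def)
  then show ?thesis using that True by (cases "V 0") auto
next
  case False
  then have "\<bar>V x\<bar> \<noteq> \<infinity>" using V x by (simp add: class_A_def)
  then show ?thesis using that by (cases "V x") auto
qed

lemma class_A_real:
  assumes "V \<in> class_A" "0 < x" obtains r where "V x = ereal r"
  using class_A_cases[OF assms(1), of x] assms(2) by (metis less_imp_le less_irrefl)

lemma class_A_slope_mono:
  assumes V: "V \<in> class_A" and "0 \<le> x" "x < y" "y < z"
  shows "slope V x z \<le> slope V x y" "slope V y z \<le> slope V x z"
proof -
  obtain b where b: "V y = ereal b" using assms class_A_real[OF V, of y] by auto
  obtain c where c: "V z = ereal c" using assms class_A_real[OF V, of z] by auto
  have "slope V x z \<le> slope V x y \<and> slope V y z \<le> slope V x z"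
    using V \<open>0 \<le> x\<close>
  proof (cases rule: class_A_cases)
    case (real a)
    define t where "t = (y - x) / (z - x)"
    have t: "t \<in> {0<..<1}" and tz: "t * (z - x) = y - x"
      using assms by (auto simp: t_def)
    then have y: "y = (1 - t) * x + t * z"
      by (simp add: algebra_simps)
    have "ereal (1 - t) * V x + ereal t * V z \<le> V ((1 - t) * x + t * z)"
      using V assms t unfolding class_A_def by auto
    then have *: "(1 - t) * a + t * c \<le> b"
      using real b c y by simp
    have "((1 - t) * a + t * c) * (z - x) \<le> b * (z - x)"
      using * assms by (intro mult_right_mono) auto
    moreover have "((1 - t) * a + t * c) * (z - x) = a * (z - x) + (c - a) * (t * (z - x))"
      by (simp add: algebra_simps)
    \<comment> \<open>Concavity at \<open>y\<close> with the denominator \<open>z - x\<close> of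
      \<open>t\<close> cleared. Both slope comparisons are rearrangements of this
      inequality.\<close>
    ultimately have **: "a * (z - x) + (c - a) * (y - x) \<le> b * (z - x)"
      by (simp add: tz)
    have "(c - a) / (z - x) \<le> (b - a) / (y - x)" "(c - b) / (z - y) \<le> (c - a) / (z - x)"
      using assms ** by (auto simp: divide_simps) (simp_all add: algebra_simps)
    then show ?thesis
      using real b c assms by (simp add: slope_def)
  \<comment> \<open>If \<open>V x = -\<infinity>\<close>, both slopes from \<open>x\<close> are
    infinite and the slope from \<open>y\<close> is finite.\<close>
  qed (use b c assms in \<open>simp add: slope_def\<close>)
  then show "slope V x z \<le> slope V x y" "slope V y z \<le> slope V x z" by auto
qed

text \<open>Slopes from \<open>x\<close> grow as \<open>z\<close> decreases to \<open>x\<close>, so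
  their limit exists and is the supremum. In this form, a bound on all slopes bounds the derivative,
  and any value below the derivative is exceeded by a single slope.\<close>

lemma class_A_right_deriv:
  assumes V: "V \<in> class_A" and x: "0 \<le> x"
  shows "right_deriv V x = (SUP z\<in>{x<..}. slope V x z)"
proof -
  let ?L = "SUP z\<in>{x<..}. slope V x z"
  have "(slope V x \<longlongrightarrow> ?L) (at_right x)"
  proof (rule order_tendstoI)
    fix a assume "a < ?L"
    then obtain z where z: "x < z" "a < slope V x z" by (auto simp: less_SUP_iff)
    from eventually_at_right_real[OF z(1)] show "\<forall>\<^sub>F w in at_right x. a < slope V x w"
    proof eventually_elim
      case (elim w)
      then show ?case using class_A_slope_mono(1)[OF V x, of w z] z by (auto intro: less_le_trans[OF z(2)])
    qed
  next
    fix a assume a: "?L < a"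
    show "\<forall>\<^sub>F w in at_right x. slope V x w < a"
      using eventually_at_right_less[of x]
      by eventually_elim (auto intro!: le_less_trans[OF _ a] SUP_upper)
  qed
  then show ?thesis
    unfolding right_deriv_def slope_def by (intro tendsto_Lim) auto
qed

definition secant_bounds :: "(real \<Rightarrow> ereal) \<Rightarrow> (real \<Rightarrow> ereal) \<Rightarrow> bool" where
  "secant_bounds f V \<longleftrightarrow> (\<forall>x z. 0 \<le> x \<longrightarrow> x < z \<longrightarrow> f z \<le> slope V x z \<and> slope V x z \<le> f x)"

lemma class_A_secant_bounds:
  assumes V: "V \<in> class_A" shows "secant_bounds (right_deriv V) V"
  unfolding secant_bounds_def
proof (intro allI impI conjI)
  fix x z :: real assume xz: "0 \<le> x" "x < z"
  then show "slope V x z \<le> right_deriv V x"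
    using V by (auto simp: class_A_right_deriv intro: SUP_upper)
  have "slope V z w \<le> slope V x z" if "z < w" for w
    using class_A_slope_mono[OF V xz that] by simp
  then show "right_deriv V z \<le> slope V x z"
    using V xz by (auto simp: class_A_right_deriv intro: SUP_least)
qed

section \<open>Continuity and right-hand derivatives of utility functions\<close>

lemma class_A_isCont:
  assumes V: "V \<in> class_A" and x: "0 < x" shows "isCont V x"
proof -
  define v where "v t = real_of_ereal (V t)" for t
  have v: "V t = ereal (v t)" if "0 < t" for t
    by (rule class_A_real[OF V that]) (simp add: v_def)
  \<comment> \<open>On the open half-line \<open>V\<close> is finite, so continuity follows from
    that of real convex functions on open sets.\<close>
  have "convex_on {0<..} (\<lambda>t. - v t)"
  proof (rule convex_onI)
    fix t a b :: real assume *: "0 < t" "t < 1" "a \<in> {0<..}" "b \<in> {0<..}"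
    have "ereal (1 - t) * V a + ereal t * V b \<le> V ((1 - t) * a + t * b)"
      using V * unfolding class_A_def by auto
    moreover have "0 < (1 - t) * a + t * b" using * by (simp add: add_pos_pos)
    ultimately have "(1 - t) * v a + t * v b \<le> v ((1 - t) * a + t * b)"
      using * by (simp add: v)
    then show "- v ((1 - t) *\<^sub>R a + t *\<^sub>R b) \<le> (1 - t) * - v a + t * - v b"
      by simp
  qed simp
  then have "continuous_on {0<..} (\<lambda>t. - v t)"
    by (intro convex_on_continuous) auto
  then have "continuous_on {0<..} v"
    using continuous_on_minus by fastforce
  then have "isCont v x" using x by (simp add: continuous_on_eq_continuous_at)
  then have "isCont (\<lambda>t. ereal (v t)) x" by (simp add: isCont_def)
  moreover have "\<forall>\<^sub>F t in nhds x. V t = ereal (v t)"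
    using eventually_nhds_in_open[of "{0<..}" x] x by (auto simp: v elim: eventually_mono)
  ultimately show ?thesis by (simp add: isCont_cong)
qed

lemma class_A_tendsto_right:
  assumes V: "V \<in> class_A" and x: "0 \<le> x" shows "(V \<longlongrightarrow> V x) (at_right x)"
proof (cases "x = 0")
  case True
  then show ?thesis using V by (simp add: class_A_def continuous_within)
next
  case False
  then show ?thesis using class_A_isCont[OF V, of x] x
    by (auto simp: isCont_def intro: tendsto_within_subset)
qed

lemma D_plus_in_class_B:
  assumes V: "V \<in> class_A" shows "D_plus V \<in> class_B"
proof -
  let ?f = "right_deriv V"
  have lower: "slope V x z \<le> ?f x" and upper: "?f z \<le> slope V x z" if "0 \<le> x" "x < z" for x z
    using class_A_secant_bounds[OF V] that by (auto simp: secant_bounds_def)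
  have D: "D_plus V x = ?f x" if "0 \<le> x" for x using that by (simp add: D_plus_def)
  have mono: "?f z \<le> ?f x" if "0 \<le> x" "x \<le> z" for x z
    using lower[of x z] upper[of x z] that by (cases "x = z") auto
  have "0 < ?f x" if x: "0 \<le> x" for x
  proof -
    have "strict_mono_on {0..} V" using V by (simp add: class_A_def)
    then have "V x < V (x + 1)" using x by (auto intro: strict_mono_onD)
    obtain c where "V (x + 1) = ereal c" using class_A_real[OF V, of "x + 1"] x by auto
    with \<open>V x < V (x + 1)\<close> have "0 < slope V x (x + 1)"
      by (cases "V x") (auto simp: slope_def)
    then show ?thesis using lower[of x "x + 1"] x by (auto intro: less_le_trans)
  qed
  moreover have "?f x \<noteq> \<infinity>" if x: "0 < x" for x
  proof -
    obtain a b where "V (x / 2) = ereal a" "V x = ereal b"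
      using x V by (metis class_A_real half_gt_zero)
    \<comment> \<open>The slope from an interior point on the left bounds the derivative at
      \<open>x\<close>.\<close>
    then have "slope V (x / 2) x \<noteq> \<infinity>" using x by (simp add: slope_def)
    then show ?thesis using upper[of "x / 2" x] x by auto
  qed
  moreover have cont: "(?f \<longlongrightarrow> ?f x) (at_right x)" if x: "0 \<le> x" for x
  proof (rule order_tendstoI)
    fix a assume a: "?f x < a"
    show "\<forall>\<^sub>F z in at_right x. ?f z < a"
      using eventually_at_right_less[of x]
      by eventually_elim (use x in \<open>auto intro!: le_less_trans[OF _ a] mono\<close>)
  next
    fix a assume "a < ?f x"
    then obtain z where z: "x < z" "a < slope V x z"
      using V x by (auto simp: class_A_right_deriv less_SUP_iff)
    obtain c where c: "V z = ereal c" using class_A_real[OF V, of z] x z by auto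
    \<comment> \<open>With \<open>z\<close> fixed, right continuity of \<open>V\<close> keeps the
      slope from \<open>w\<close> above \<open>a\<close> for \<open>w\<close> near \<open>x\<close>,
      and that slope is at most the derivative at \<open>w\<close>.\<close>
    have "((\<lambda>w. slope V w z) \<longlongrightarrow> slope V x z) (at_right x)"
      unfolding slope_def using c z
      by (intro tendsto_divide_ereal tendsto_diff_ereal_general class_A_tendsto_right[OF V x] tendsto_intros) auto
    from order_tendstoD(1)[OF this z(2)] eventually_at_right_real[OF z(1)]
    show "\<forall>\<^sub>F z in at_right x. a < ?f z"
    proof eventually_elim
      case (elim w)
      then show ?case using lower[of w z] x by auto
    qed
  qed
  moreover have "(D_plus V \<longlongrightarrow> D_plus V x) (at_right x)" if x: "0 \<le> x" for x
    unfolding D[OF x]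
  proof (rule Lim_transform_eventually)
    show "(?f \<longlongrightarrow> ?f x) (at_right x)" using x by (rule cont)
    show "\<forall>\<^sub>F z in at_right x. right_deriv V z = D_plus V z"
      using eventually_at_right_less[of x] by eventually_elim (use D x in auto)
  qed
  moreover have "(D_plus V \<longlongrightarrow> 0) at_top"
  proof (rule Lim_transform_eventually)
    show "(right_deriv V \<longlongrightarrow> 0) at_top" using V by (simp add: class_A_def)
    show "\<forall>\<^sub>F z in at_top. right_deriv V z = D_plus V z"
      using eventually_ge_at_top[of 0] by eventually_elim (use D in auto)
  qed
  ultimately show ?thesis
    using mono by (auto simp: class_B_def monotone_on_def continuous_within D, simp add: D_plus_def)
qed

section \<open>The largest maximizer of \<open>V x - x y\<close>\<close>

lemma T_L_eq:
  assumes V: "V \<in> class_A" shows "T_L V = T_1 (D_plus V)"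
proof
  fix y :: real
  let ?f = "D_plus V"
  have B: "?f \<in> class_B" using V by (rule D_plus_in_class_B)
  have C: "T_1 ?f \<in> class_C" using B by (rule T_1_in_class_C)
  have lower: "slope V x z \<le> ?f x" and upper: "?f z \<le> slope V x z" if "0 \<le> x" "x < z" for x z
    using class_A_secant_bounds[OF V] that by (auto simp: secant_bounds_def D_plus_def)
  consider "y < 0" | "y = 0" | "0 < y" by linarith
  then show "T_L V y = T_1 (D_plus V) y"
  proof cases
    case 1
    then show ?thesis by (simp add: T_L_def T_1_def)
  next
    case 2
    then show ?thesis using C by (simp add: T_L_def class_C_def class_C0_def)
  next
    case y: 3
    have "T_1 ?f y \<noteq> \<infinity>" using C y by (simp add: class_C_def class_C0_def)
    moreover have "0 \<le> T_1 ?f y" using T_1_nonneg y by simp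
    ultimately obtain s where s: "T_1 ?f y = ereal s" "0 \<le> s"
      by (cases "T_1 ?f y") auto
    have above: "?f x < ereal y" if "s < x" for x
    proof (rule ccontr)
      assume "\<not> ?f x < ereal y"
      moreover have "\<forall>x\<ge>0. ereal y \<le> ?f x \<longrightarrow> ereal x \<le> ereal s"
        using T_1_le_iff[of y ?f "ereal s"] y s by simp
      ultimately have "x \<le> s" using that s by simp
      with that show False by simp
    qed
    have below: "ereal y \<le> ?f x" if "0 \<le> x" "x < s" for x
    proof -
      have "\<exists>z\<ge>0. ereal y \<le> ?f z \<and> x < z"
        using less_T_1_iff[of y "ereal x" ?f, OF less_imp_le[OF y]] s(1) that by auto
      then obtain z where z: "0 \<le> z" "ereal y \<le> ?f z" "x < z" by auto
      have "?f z \<le> ?f x"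
        using B z that by (auto simp: class_B_def monotone_on_def)
      with z show ?thesis by order
    qed
    define g where "g x = V x - ereal (x * y)" for x
    \<comment> \<open>The increment of \<open>g\<close> has the sign of the slope minus
      \<open>y\<close>. The three versions treat \<open>V 0 = -\<infinity>\<close> separately: there
      the slope is infinite, which contradicts the assumption of the first two, while
      \<open>g 0 = -\<infinity>\<close> settles the third.\<close>
    have g_le: "g z \<le> g x" if "0 \<le> x" "x < z" "slope V x z \<le> ereal y" for x z
      using V \<open>0 \<le> x\<close>
    proof (cases rule: class_A_cases)
      case (real a)
      obtain c where "V z = ereal c"
        using class_A_real[OF V, of z] \<open>0 \<le> x\<close> \<open>x < z\<close> by auto
      then show ?thesis using real that
        by (simp add: slope_def g_def pos_divide_le_eq algebra_simps)
    next
      case MInf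
      obtain c where "V z = ereal c"
        using class_A_real[OF V, of z] \<open>0 \<le> x\<close> \<open>x < z\<close> by auto
      then show ?thesis using MInf that by (simp add: slope_def)
    qed
    have g_less: "g z < g x" if "0 \<le> x" "x < z" "slope V x z < ereal y" for x z
      using V \<open>0 \<le> x\<close>
    proof (cases rule: class_A_cases)
      case (real a)
      obtain c where "V z = ereal c"
        using class_A_real[OF V, of z] \<open>0 \<le> x\<close> \<open>x < z\<close> by auto
      then show ?thesis using real that
        by (simp add: slope_def g_def pos_divide_less_eq algebra_simps)
    next
      case MInf
      obtain c where "V z = ereal c"
        using class_A_real[OF V, of z] \<open>0 \<le> x\<close> \<open>x < z\<close> by auto
      then show ?thesis using MInf that by (simp add: slope_def)
    qed
    have g_ge: "g x \<le> g z" if "0 \<le> x" "x < z" "ereal y \<le> slope V x z" for x z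
      using V \<open>0 \<le> x\<close>
    proof (cases rule: class_A_cases)
      case (real a)
      obtain c where "V z = ereal c"
        using class_A_real[OF V, of z] \<open>0 \<le> x\<close> \<open>x < z\<close> by auto
      then show ?thesis using real that
        by (simp add: slope_def g_def pos_le_divide_eq algebra_simps)
    next
      case MInf
      then show ?thesis by (simp add: g_def)
    qed
    \<comment> \<open>Neither \<open>above\<close> nor \<open>below\<close> speaks of
      \<open>s\<close> itself. So \<open>z\<close> is compared with points \<open>t\<close> between
      \<open>z\<close> and \<open>s\<close>, and then \<open>t\<close> tends to \<open>s\<close> by
      continuity of \<open>g\<close>.\<close>
    have max: "g z \<le> g s" if "0 \<le> z" for z
    proof -
      consider "s < z" | "z = s" | "z < s" by linarith
      then show ?thesis
      proof cases
        case 1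
        have "(g \<longlongrightarrow> g s) (at_right s)"
          unfolding g_def
          by (intro tendsto_diff_ereal_general class_A_tendsto_right[OF V] s tendsto_intros) auto
        moreover have "\<forall>\<^sub>F t in at_right s. g z \<le> g t"
          using eventually_at_right_real[OF 1]
        proof eventually_elim
          case (elim t)
          then show ?case using lower[of t z] above[of t] s by (intro g_le) auto
        qed
        ultimately show ?thesis by (intro tendsto_lowerbound[of g]) auto
      next
        case 3
        then have "0 < s" using that by simp
        then have "(V \<longlongrightarrow> V s) (at_left s)"
          using class_A_isCont[OF V] by (auto simp: isCont_def intro: tendsto_within_subset)
        then have "(g \<longlongrightarrow> g s) (at_left s)"
          unfolding g_def
          by (intro tendsto_diff_ereal_general tendsto_intros) auto
        moreover have "\<forall>\<^sub>F t in at_left s. g z \<le> g t"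
          using eventually_at_left_real[OF 3]
        proof eventually_elim
          case (elim t)
          then have "ereal y \<le> slope V z t" using upper[of z t] below[of t] that by auto
          then show ?case using elim that by (intro g_ge) auto
        qed
        ultimately show ?thesis by (intro tendsto_lowerbound[of g]) auto
      qed simp
    qed
    define S where "S = {x. is_arg_max g (\<lambda>x. 0 \<le> x) x}"
    have "s \<in> S" using max s by (auto simp: S_def is_arg_max_def not_less)
    moreover have "x \<le> s" if "x \<in> S" for x
    proof (rule ccontr)
      assume "\<not> x \<le> s"
      \<comment> \<open>The derivative at \<open>s\<close> may still be at least \<open>y\<close>,
        whereas at a point strictly between \<open>s\<close> and \<open>x\<close> it is below
        \<open>y\<close>; hence \<open>x\<close> is strictly worse than \<open>t\<close>.\<close>
      define t where "t = (s + x) / 2"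
      have t: "s < t" "t < x" using \<open>\<not> x \<le> s\<close> by (auto simp: t_def)
      have "g x < g t"
        using lower[of t x] above[of t] s t by (intro g_less) auto
      then show False using that t s by (auto simp: S_def is_arg_max_def)
    qed
    ultimately have "sup0 S = ereal s"
      by (auto simp: sup0_def intro!: antisym SUP_least SUP_upper)
    then show ?thesis using y s by (simp add: T_L_def S_def g_def[abs_def])
  qed
qed

section \<open>Reconstruction from the right-hand derivative\<close>

text \<open>The secant inequality is summed over \<open>n\<close> equal pieces and the increments
  telescope. Since \<open>secant\<close> makes \<phi> decreasing, right endpoints give the lower and
  left endpoints the upper Darboux sum.\<close>

lemma sum_uniform_partition_bounds:
  fixes v \<phi> :: "real \<Rightarrow> real"
  assumes ab: "a < b" and n: "0 < n"
    and secant: "\<And>x z. a \<le> x \<Longrightarrow> x < z \<Longrightarrow> z \<le> b \<Longrightarrow> \<phi> z * (z - x) \<le> v z - v x \<and> v z - v x \<le> \<phi> x * (z - x)"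
  defines "p \<equiv> \<lambda>i. a + real i * ((b - a) / real n)"
  shows "(\<Sum>i<n. \<phi> (p (Suc i))) * ((b - a) / real n) \<le> v b - v a"
    and "v b - v a \<le> (\<Sum>i<n. \<phi> (p i)) * ((b - a) / real n)"
proof -
  let ?h = "(b - a) / real n"
  have h: "0 < ?h" using assms by simp
  have step: "p (Suc i) - p i = ?h" for i by (simp add: p_def distrib_right add_divide_distrib)
  have p0: "p 0 = a" and pn: "p n = b" using assms by (simp_all add: p_def)
  have bnd: "a \<le> p i" "p i < p (Suc i)" "p (Suc i) \<le> b" if "i < n" for i
  proof -
    show "a \<le> p i" using ab by (simp add: p_def)
    show "p i < p (Suc i)" using step[of i] h by linarith
    have "real (Suc i) * ?h \<le> real n * ?h" using that h by (intro mult_right_mono) auto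
    then show "p (Suc i) \<le> b" using pn by (simp add: p_def)
  qed
  have tele: "v b - v a = (\<Sum>i<n. v (p (Suc i)) - v (p i))"
    using sum_lessThan_telescope[of "\<lambda>i. v (p i)" n] by (simp add: p0 pn)
  show "(\<Sum>i<n. \<phi> (p (Suc i))) * ?h \<le> v b - v a"
    unfolding tele sum_distrib_right
    using secant[OF bnd] by (intro sum_mono) (auto simp: step)
  show "v b - v a \<le> (\<Sum>i<n. \<phi> (p i)) * ?h"
    unfolding tele sum_distrib_right
    using secant[OF bnd] by (intro sum_mono) (auto simp: step)
qed

text \<open>Both increments lie between the lower and the upper Darboux sum, which differ by \<open>O(1/n)\<close>.\<close>

lemma increment_unique:
  fixes v w \<phi> :: "real \<Rightarrow> real"
  assumes ab: "a \<le> b"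
    and v: "\<And>x z. a \<le> x \<Longrightarrow> x < z \<Longrightarrow> z \<le> b \<Longrightarrow> \<phi> z * (z - x) \<le> v z - v x \<and> v z - v x \<le> \<phi> x * (z - x)"
    and w: "\<And>x z. a \<le> x \<Longrightarrow> x < z \<Longrightarrow> z \<le> b \<Longrightarrow> \<phi> z * (z - x) \<le> w z - w x \<and> w z - w x \<le> \<phi> x * (z - x)"
  shows "v b - v a = w b - w a"
proof (cases "a = b")
  case False
  with ab have ab: "a < b" by simp
  let ?d = "(v b - v a) - (w b - w a)" and ?c = "(\<phi> a - \<phi> b) * (b - a)"
  have "\<bar>?d\<bar> \<le> ?c / real n" if n: "0 < n" for n
  proof -
    define p where "p i = a + real i * ((b - a) / real n)" for i
    have p: "p 0 = a" "p n = b" using n by (simp_all add: p_def)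
    have "\<bar>?d\<bar> \<le> (\<Sum>i<n. \<phi> (p i)) * ((b - a) / real n) - (\<Sum>i<n. \<phi> (p (Suc i))) * ((b - a) / real n)"
      using sum_uniform_partition_bounds[OF ab n, of \<phi> v, OF v]
        sum_uniform_partition_bounds[OF ab n, of \<phi> w, OF w]
      unfolding p_def[symmetric] by linarith
    also have "\<dots> = (\<Sum>i<n. \<phi> (p i) - \<phi> (p (Suc i))) * ((b - a) / real n)"
      by (simp add: sum_subtractf left_diff_distrib diff_divide_distrib)
    \<comment> \<open>The two sums are shifts of each other, so only the end values survive.\<close>
    also have "(\<Sum>i<n. \<phi> (p i) - \<phi> (p (Suc i))) = \<phi> a - \<phi> b"
      using sum_lessThan_telescope'[of "\<lambda>i. \<phi> (p i)" n] by (simp add: p)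
    finally show ?thesis by simp
  qed
  then have "\<forall>\<^sub>F n in sequentially. \<bar>?d\<bar> \<le> ?c / real n"
    by (intro eventually_mono[OF eventually_gt_at_top[of 0]])
  moreover have "(\<lambda>n. ?c / real n) \<longlonglongrightarrow> 0" by (rule lim_const_over_n)
  ultimately have "\<bar>?d\<bar> \<le> 0" by (intro tendsto_lowerbound[of "\<lambda>n. ?c / real n"]) auto
  then show ?thesis by simp
qed simp

text \<open>On the open half-line all values are finite and \<open>increment_unique\<close> applies;
  the normalization at \<open>1\<close> removes the additive constant.\<close>

lemma secant_bounds_unique:
  assumes V: "V \<in> class_A" "secant_bounds f V" and W: "W \<in> class_A" "secant_bounds f W"
    and f: "f \<in> class_B"
  shows "V = W"
proof
  fix x :: real
  have pos: "V x = W x" if x: "0 < x" for x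
  proof -
    define v w \<phi> where "v t = real_of_ereal (V t)" and "w t = real_of_ereal (W t)"
      and "\<phi> t = real_of_ereal (f t)" for t
    have v: "V t = ereal (v t)" if "0 < t" for t
      by (rule class_A_real[OF V(1) that]) (simp add: v_def)
    have w: "W t = ereal (w t)" if "0 < t" for t
      by (rule class_A_real[OF W(1) that]) (simp add: w_def)
    have \<phi>: "f t = ereal (\<phi> t)" if "0 < t" for t
    proof -
      have "0 < f t" "f t \<noteq> \<infinity>" using f that by (auto simp: class_B_def)
      then show ?thesis by (cases "f t") (auto simp: \<phi>_def)
    qed
    have bv: "\<phi> z * (z - x) \<le> v z - v x \<and> v z - v x \<le> \<phi> x * (z - x)" if "0 < x" "x < z" for x z
    proof -
      have "f z \<le> slope V x z \<and> slope V x z \<le> f x"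
        using V(2) that by (simp add: secant_bounds_def)
      then show ?thesis
        using that by (simp add: slope_def v \<phi> pos_le_divide_eq pos_divide_le_eq)
    qed
    have bw: "\<phi> z * (z - x) \<le> w z - w x \<and> w z - w x \<le> \<phi> x * (z - x)" if "0 < x" "x < z" for x z
    proof -
      have "f z \<le> slope W x z \<and> slope W x z \<le> f x"
        using W(2) that by (simp add: secant_bounds_def)
      then show ?thesis
        using that by (simp add: slope_def w \<phi> pos_le_divide_eq pos_divide_le_eq)
    qed
    have "v 1 = 0" "w 1 = 0" using V W by (auto simp: class_A_def v_def w_def)
    \<comment> \<open>Minimum and maximum treat the two positions of \<open>x\<close> relative to
      \<open>1\<close> at once.\<close>
    moreover have "v (max x 1) - v (min x 1) = w (max x 1) - w (min x 1)"
      using x by (intro increment_unique[of _ _ \<phi>] bv bw) auto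
    ultimately show ?thesis using x by (cases "x \<le> 1") (auto simp: v w)
  qed
  consider "x < 0" | "x = 0" | "0 < x" by linarith
  then show "V x = W x"
  proof cases
    case 1
    then show ?thesis using V W by (auto simp: class_A_def extensional_def)
  next
    case 2
    \<comment> \<open>At \<open>0\<close> the values may be infinite, but they are the right limits
      of functions that agree.\<close>
    have "\<forall>\<^sub>F t in at_right 0. V t = W t"
      using eventually_at_right_less[of 0] by eventually_elim (rule pos)
    with class_A_tendsto_right[OF V(1), of 0] have "(W \<longlongrightarrow> V 0) (at_right 0)"
      by (simp add: tendsto_cong)
    then show ?thesis
      using class_A_tendsto_right[OF W(1), of 0] 2 tendsto_unique[OF trivial_limit_at_right_real] by auto
  next
    case 3
    then show ?thesis by (rule pos)
  qed
qed

section \<open>From secant bounds back to concavity and the derivative\<close>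

lemma secant_bounds_right_deriv:
  assumes f: "f \<in> class_B" and sb: "secant_bounds f V" and x: "0 \<le> x"
  shows "right_deriv V x = f x"
proof -
  have lim: "(f \<longlongrightarrow> f x) (at_right x)"
    using f x by (simp add: class_B_def continuous_within)
  have "\<forall>\<^sub>F z in at_right x. f z \<le> slope V x z" "\<forall>\<^sub>F z in at_right x. slope V x z \<le> f x"
    using eventually_at_right_less[of x]
    by (eventually_elim, use sb x in \<open>auto simp: secant_bounds_def\<close>)+
  \<comment> \<open>The slope is squeezed between \<open>f z\<close> and \<open>f x\<close>, and
    \<open>f z\<close> tends to \<open>f x\<close> by right continuity.\<close>
  then have "(slope V x \<longlongrightarrow> f x) (at_right x)"
    by (rule tendsto_sandwich[OF _ _ lim tendsto_const])
  then show ?thesis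
    unfolding right_deriv_def slope_def by (intro tendsto_Lim) auto
qed

lemma secant_bounds_class_A:
  assumes f: "f \<in> class_B" and sb: "secant_bounds f V"
    and ext: "V \<in> extensional {0..}" and fin: "\<And>x. 0 < x \<Longrightarrow> \<bar>V x\<bar> \<noteq> \<infinity>" and V0: "V 0 \<noteq> \<infinity>"
    and cont: "continuous (at_right 0) V" and V1: "V 1 = 0"
  shows "V \<in> class_A"
proof -
  have pos: "0 < f x" if "0 \<le> x" for x using f that by (simp add: class_B_def)
  have lower: "f z \<le> slope V x z" and upper: "slope V x z \<le> f x" if "0 \<le> x" "x < z" for x z
    using sb that by (auto simp: secant_bounds_def)
  have V_cases: "(\<exists>r. V x = ereal r) \<or> x = 0 \<and> V x = -\<infinity>" if "0 \<le> x" for x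
    using fin[of x] V0 that by (cases "V x"; cases "x = 0") auto
  have V_real: "\<exists>r. V x = ereal r" if "0 < x" for x
    using fin[of x] that by (cases "V x") auto
  have conc: "ereal (1 - t) * V x + ereal t * V z \<le> V ((1 - t) * x + t * z)"
    if "0 \<le> x" "x < z" "0 < t" "t < 1" for x z t
  proof -
    define m where "m = (1 - t) * x + t * z"
    have mx: "m - x = t * (z - x)" and zm: "z - m = (1 - t) * (z - x)"
      by (simp_all add: m_def algebra_simps)
    have m: "x < m" "m < z"
      using mx zm that mult_pos_pos[of t "z - x"] mult_pos_pos[of "1 - t" "z - x"] by linarith+
    obtain b where b: "V m = ereal b" using V_real[of m] m \<open>0 \<le> x\<close> by auto
    obtain c where c: "V z = ereal c" using V_real[of z] m \<open>0 \<le> x\<close> by auto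
    show ?thesis
    proof (cases "V x = -\<infinity>")
      case True
      then show ?thesis using that c by simp
    next
      case False
      then obtain a where a: "V x = ereal a" using V_cases[of x] \<open>0 \<le> x\<close> by auto
      \<comment> \<open>\<open>f m\<close> separates the two slopes: it bounds those starting at
        \<open>m\<close> from above and those ending at \<open>m\<close> from below. This is
        concavity at \<open>m\<close>.\<close>
      have "slope V m z \<le> slope V x m"
        using upper[of m z] lower[of x m] m that by auto
      then have "(c - b) / ((1 - t) * (z - x)) \<le> (b - a) / (t * (z - x))"
        using m \<open>0 < t\<close> \<open>t < 1\<close> by (simp add: slope_def a b c mx zm)
      then have "(c - b) / (1 - t) \<le> (b - a) / t"
        using that by (simp add: divide_simps)
      then have "(c - b) * t \<le> (b - a) * (1 - t)"
        using that by (simp add: divide_simps mult.commute)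
      then have "(1 - t) * a + t * c \<le> b"
        by (simp add: algebra_simps)
      then show ?thesis
        using a b c by (simp add: m_def[symmetric])
    qed
  qed
  have "ereal (1 - t) * V x + ereal t * V z \<le> V ((1 - t) * x + t * z)"
    if "0 \<le> x" "0 \<le> z" "t \<in> {0<..<1}" for x z t
  proof -
    consider "x < z" | "x = z" | "z < x" by linarith
    then show ?thesis
    proof cases
      case 1
      then show ?thesis using conc that by auto
    next
      case 2
      have "(1 - t) * z + t * z = z" by (simp add: algebra_simps)
      then show ?thesis using 2 V_cases[of z] that by (auto simp: algebra_simps)
    next
      case 3
      then show ?thesis using conc[of z x "1 - t"] that by (simp add: add.commute)
    qed
  qed
  moreover have "strict_mono_on {0..} V"
  proof (rule strict_mono_onI)
    fix x z :: real assume xz: "x \<in> {0..}" "x < z"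
    have "0 < slope V x z" using less_le_trans[OF pos lower] xz by auto
    then show "V x < V z"
      using V_cases[of x] V_real[of z] xz by (auto simp: slope_def zero_less_divide_iff)
  qed
  moreover have "(right_deriv V \<longlongrightarrow> 0) at_top"
  proof (rule Lim_transform_eventually)
    show "(f \<longlongrightarrow> 0) at_top" using f by (simp add: class_B_def)
    show "\<forall>\<^sub>F z in at_top. f z = right_deriv V z"
      using eventually_ge_at_top[of 0]
      by eventually_elim (simp add: secant_bounds_right_deriv[OF f sb])
  qed
  ultimately show ?thesis using ext fin cont V1 by (simp add: class_A_def)
qed

lemma secant_bounds_D_plus:
  assumes f: "f \<in> class_B" and sb: "secant_bounds f V" shows "D_plus V = f"
proof
  fix x :: real
  show "D_plus V x = f x"
    using f secant_bounds_right_deriv[OF f sb, of x]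
    by (cases "0 \<le> x") (auto simp: D_plus_def class_B_def extensional_def)
qed

section \<open>The integral operator \<open>T_0\<close>\<close>

lemma T_0_in_class_A:
  assumes f: "f \<in> class_B"
  shows "T_0 f \<in> class_A" and "secant_bounds f (T_0 f)"
proof -
  have pos: "0 < f x" if "0 \<le> x" for x using f that by (simp add: class_B_def)
  have fin: "f x \<noteq> \<infinity>" if "0 < x" for x using f that by (simp add: class_B_def)
  have mono: "f z \<le> f x" if "0 \<le> x" "x \<le> z" for x z
    using f that by (auto simp: class_B_def monotone_on_def)
  \<comment> \<open>Continuing \<open>f\<close> to the left by \<open>f 0\<close> makes it
    decreasing on the whole line, so its superlevel sets are intervals and it is Borel
    measurable.\<close>
  define g where "g x = e2ennreal (f (max 0 x))" for x
  have g[measurable]: "g \<in> borel_measurable lborel"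
  proof (rule borel_measurableI_ge)
    fix y
    have "is_interval {x. y \<le> g x}"
      unfolding is_interval_1
    proof (intro ballI allI impI)
      fix a b x :: real assume "b \<in> {x. y \<le> g x}" "a \<le> x \<and> x \<le> b"
      moreover from this have "g b \<le> g x"
        by (auto simp: g_def intro!: e2ennreal_mono mono)
      ultimately show "x \<in> {x. y \<le> g x}" by auto
    qed
    then show "{x \<in> space lborel. y \<le> g x} \<in> sets lborel"
      by (simp add: real_interval_borel_measurable)
  qed
  define N where "N a b = (\<integral>\<^sup>+t\<in>{a..b}. g t \<partial>lborel)" for a b
  define M where "M a b = enn2ereal (N a b)" for a b
  have N_f: "(\<integral>\<^sup>+t\<in>{a..b}. e2ennreal (f t) \<partial>lborel) = N a b" if "0 \<le> a" for a b
    unfolding N_def using that by (intro set_nn_integral_cong) (auto simp: g_def max_def)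
  \<comment> \<open>A single point is a null set even where \<open>g\<close> is infinite. Half-open
    intervals make the pieces in \<open>N_add\<close> disjoint.\<close>
  have N_Ioc: "(\<integral>\<^sup>+t\<in>{a<..b}. g t \<partial>lborel) = N a b" for a b
    unfolding N_def
  proof (rule nn_integral_cong_AE)
    show "AE x in lborel. g x * indicator {a<..b} x = g x * indicator {a..b} x"
      using AE_lborel_singleton[of a] by eventually_elim (auto simp: indicator_def)
  qed
  have N_add: "N a c = N a b + N b c" if "a \<le> b" "b \<le> c" for a b c
  proof -
    have "N a c = (\<integral>\<^sup>+t\<in>{a..b} \<union> {b<..c}. g t \<partial>lborel)"
      unfolding N_def using that by (simp add: ivl_disj_un)
    also have "\<dots> = N a b + (\<integral>\<^sup>+t\<in>{b<..c}. g t \<partial>lborel)"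
      unfolding N_def by (rule nn_integral_disjoint_pair) auto
    finally show ?thesis by (simp add: N_Ioc)
  qed
  have M_add: "M a c = M a b + M b c" if "a \<le> b" "b \<le> c" for a b c
    using N_add[OF that] by (simp add: M_def plus_ennreal.rep_eq)
  have M_nonneg: "0 \<le> M a b" for a b by (simp add: M_def)
  have M_upper: "M a b \<le> f a * ereal (b - a)" if "0 \<le> a" "a \<le> b" for a b
  proof -
    have "N a b \<le> (\<integral>\<^sup>+t. e2ennreal (f a) * indicator {a..b} t \<partial>lborel)"
      unfolding N_def using that
      by (intro nn_integral_mono) (auto simp: indicator_def g_def intro!: e2ennreal_mono mono)
    also have "\<dots> = e2ennreal (f a) * ennreal (b - a)"
      using that by (subst nn_integral_cmult_indicator) auto
    finally have "M a b \<le> enn2ereal (e2ennreal (f a) * ennreal (b - a))"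
      by (simp add: M_def less_eq_ennreal.rep_eq)
    then show ?thesis
      using that pos[of a] by (simp add: times_ennreal.rep_eq enn2ereal_e2ennreal)
  qed
  have M_lower: "f b * ereal (b - a) \<le> M a b" if "0 \<le> a" "a \<le> b" for a b
  proof -
    have "(\<integral>\<^sup>+t. e2ennreal (f b) * indicator {a..b} t \<partial>lborel) \<le> N a b"
      unfolding N_def using that
      by (intro nn_integral_mono) (auto simp: indicator_def g_def intro!: e2ennreal_mono mono)
    moreover have "(\<integral>\<^sup>+t. e2ennreal (f b) * indicator {a..b} t \<partial>lborel) = e2ennreal (f b) * ennreal (b - a)"
      using that by (subst nn_integral_cmult_indicator) auto
    ultimately have "enn2ereal (e2ennreal (f b) * ennreal (b - a)) \<le> M a b"
      by (simp add: M_def less_eq_ennreal.rep_eq)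
    then show ?thesis
      using that pos[of b] by (simp add: times_ennreal.rep_eq enn2ereal_e2ennreal)
  qed
  have M_fin: "\<exists>r. M a b = ereal r" if "0 < a" "a \<le> b" for a b
  proof -
    obtain r where "f a = ereal r" using fin[OF \<open>0 < a\<close>] pos[of a] \<open>0 < a\<close> by (cases "f a") auto
    then show ?thesis using M_upper[of a b] M_nonneg[of a b] that by (cases "M a b") auto
  qed
  have M_refl: "M 1 1 = 0" using M_upper[of 1 1] M_nonneg[of 1 1] by (simp flip: zero_ereal_def)
  have T0_ge: "T_0 f x = M 1 x" if "1 \<le> x" for x
    using that by (simp add: T_0_def N_f M_def)
  have T0_le: "T_0 f x = - M x 1" if "0 \<le> x" "x \<le> 1" for x
    using that M_refl T0_ge[of 1] by (cases "x = 1") (simp_all add: T_0_def N_f M_def)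
  have T0_fin: "\<exists>r. T_0 f x = ereal r" if "0 < x" for x
    using M_fin[of 1 x] M_fin[of x 1] T0_ge[of x] T0_le[of x] that by (cases "1 \<le> x") auto
  have diff: "T_0 f z - T_0 f x = M x z" if "0 \<le> x" "x < z" for x z
  proof -
    consider "1 \<le> x" | "x < 1" "1 \<le> z" | "z < 1" by linarith
    then show ?thesis
    proof cases
      case 1
      then obtain a b where "M 1 x = ereal a" "M x z = ereal b"
        using M_fin[of 1 x] M_fin[of x z] \<open>x < z\<close> by auto
      then show ?thesis using 1 that M_add[of 1 x z] by (simp add: T0_ge)
    next
      case 2
      then show ?thesis using M_add[of x 1 z] that
        by (simp add: T0_ge T0_le minus_ereal_def add.commute)
    next
      case 3
      \<comment> \<open>Since \<open>z > 0\<close>, this term is finite and cancels even if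
        \<open>M x z\<close> is infinite, as can happen for \<open>x = 0\<close>.\<close>
      then obtain b where "M z 1 = ereal b" using M_fin[of z 1] \<open>0 \<le> x\<close> \<open>x < z\<close> by auto
      then show ?thesis using 3 that M_add[of x z 1] M_nonneg[of x z]
        by (cases "M x z") (auto simp add: T0_le)
    qed
  qed
  show sb: "secant_bounds f (T_0 f)"
    unfolding secant_bounds_def
  proof (intro allI impI conjI)
    fix x z :: real assume xz: "0 \<le> x" "x < z"
    show "f z \<le> slope (T_0 f) x z"
      using M_lower[of x z] xz
      by (simp add: slope_def diff ereal_le_divide_pos mult.commute)
    show "slope (T_0 f) x z \<le> f x"
      using M_upper[of x z] xz
      by (simp add: slope_def diff ereal_divide_le_pos mult.commute)
  qed
  have "((\<lambda>x. N x 1) \<longlongrightarrow> N 0 1) (at_right 0)"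
  proof (rule order_tendstoI)
    fix a assume a: "N 0 1 < a"
    show "\<forall>\<^sub>F x in at_right 0. N x 1 < a"
      using eventually_at_right_less[of 0]
      by eventually_elim (auto simp: N_def intro!: le_less_trans[OF _ a[unfolded N_def]] nn_set_integral_set_mono)
  next
    fix a assume a: "a < N 0 1"
    \<comment> \<open>Continuity of the measure with density \<open>g\<close> along sets increasing
      to \<open>{0<..1}\<close> shows that \<open>N x 1\<close> exceeds \<open>a\<close> for small
      \<open>x\<close>, whether \<open>N 0 1\<close> is finite or not.\<close>
    define D where "D = density lborel g"
    define A where "A n = {1 / real (Suc n)..1}" for n
    have D: "emeasure D S = (\<integral>\<^sup>+t\<in>S. g t \<partial>lborel)" if "S \<in> sets borel" for S
      using that by (simp add: D_def emeasure_density)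
    have "(\<Union>n. A n) = {0<..1}"
    proof (intro equalityI subsetI)
      fix x :: real assume x: "x \<in> {0<..1}"
      then obtain n where "inverse (real (Suc n)) < x" using reals_Archimedean by auto
      then show "x \<in> (\<Union>n. A n)" using x by (auto simp: A_def inverse_eq_divide intro!: exI[of _ n])
    next
      fix x assume "x \<in> (\<Union>n. A n)"
      then obtain n where "1 / real (Suc n) \<le> x" "x \<le> 1" by (auto simp: A_def)
      moreover have "0 < 1 / real (Suc n)" by simp
      ultimately show "x \<in> {0<..1}" by (metis greaterThanAtMost_iff less_le_trans)
    qed
    then have "emeasure D (\<Union>n. A n) = N 0 1"
      by (simp add: D N_Ioc)
    moreover have "(SUP n. emeasure D (A n)) = emeasure D (\<Union>n. A n)"
      by (rule SUP_emeasure_incseq) (auto simp: A_def D_def incseq_def frac_le intro: order_trans[rotated])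
    moreover have "emeasure D (A n) = N (1 / real (Suc n)) 1" for n
      unfolding A_def N_def by (rule D) simp
    ultimately have "a < (SUP n. N (1 / real (Suc n)) 1)"
      using a by simp
    then obtain n where n: "a < N (1 / real (Suc n)) 1"
      unfolding less_SUP_iff by blast
    have "0 < 1 / real (Suc n)" by simp
    from eventually_at_right_real[OF this] show "\<forall>\<^sub>F x in at_right 0. a < N x 1"
      by eventually_elim (auto simp: N_def intro!: less_le_trans[OF n[unfolded N_def]] nn_set_integral_set_mono)
  qed
  then have "((\<lambda>x. M x 1) \<longlongrightarrow> M 0 1) (at_right 0)"
    unfolding M_def by simp
  then have "((\<lambda>x. - M x 1) \<longlongrightarrow> - M 0 1) (at_right 0)"
    by (rule tendsto_uminus_ereal)
  moreover have "\<forall>\<^sub>F x in at_right 0. - M x 1 = T_0 f x"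
    using eventually_at_right_real[OF zero_less_one] by eventually_elim (simp add: T0_le)
  ultimately have "(T_0 f \<longlongrightarrow> T_0 f 0) (at_right 0)"
    by (simp add: Lim_transform_eventually T0_le)
  then have cont: "continuous (at_right 0) (T_0 f)" by (simp add: continuous_within)
  show "T_0 f \<in> class_A"
  proof (rule secant_bounds_class_A[OF f sb _ _ _ cont])
    show "T_0 f \<in> extensional {0..}" by (simp add: T_0_def)
    show "\<bar>T_0 f x\<bar> \<noteq> \<infinity>" if "0 < x" for x using T0_fin[OF that] by auto
    show "T_0 f 0 \<noteq> \<infinity>" using M_nonneg[of 0 1] by (auto simp: T0_le ereal_uminus_eq_reorder)
    show "T_0 f 1 = 0" using T0_ge[of 1] M_refl by simp
  qed
qed

lemma T_0_D_plus:
  assumes V: "V \<in> class_A" shows "T_0 (D_plus V) = V"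
proof (rule secant_bounds_unique)
  show B: "D_plus V \<in> class_B" using V by (rule D_plus_in_class_B)
  show "T_0 (D_plus V) \<in> class_A" "secant_bounds (D_plus V) (T_0 (D_plus V))"
    using T_0_in_class_A[OF B] by auto
  show "secant_bounds (D_plus V) V"
    using class_A_secant_bounds[OF V] by (simp add: secant_bounds_def D_plus_def)
qed (rule V)

lemma D_plus_T_0: "f \<in> class_B \<Longrightarrow> D_plus (T_0 f) = f"
  by (simp add: secant_bounds_D_plus T_0_in_class_A)

section \<open>Assembly of the bijection\<close>

theorem theorem1:
  shows "(D_plus \<in> class_A \<rightarrow> class_B \<and> T_0 \<in> class_B \<rightarrow> class_A \<and>
          T_1 \<in> class_B \<rightarrow> class_C \<and> T_2 \<in> class_C \<rightarrow> class_B) \<and>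
         bij_betw T_L class_A class_C \<and>
         (\<forall>V\<in>class_A. T_L V = (T_1 \<circ> D_plus) V) \<and>
         (\<forall>f\<in>class_C. inv_into class_A T_L f = (T_0 \<circ> T_2) f)"
proof (intro conjI ballI)
  show "D_plus \<in> class_A \<rightarrow> class_B" using D_plus_in_class_B by blast
  show "T_0 \<in> class_B \<rightarrow> class_A" using T_0_in_class_A by blast
  show "T_1 \<in> class_B \<rightarrow> class_C" using T_1_in_class_C by blast
  show "T_2 \<in> class_C \<rightarrow> class_B" using T_2_in_class_B by blast
  show bij: "bij_betw T_L class_A class_C"
    \<comment> \<open>In either composite of \<open>T_1 \<circ> D_plus\<close> with the witness, the
      inner inverse pair cancels first and then the outer one.\<close>
    by (rule bij_betw_byWitness[where f' = "T_0 \<circ> T_2"])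
      (auto simp: T_L_eq T_2_T_1 T_1_T_2 T_0_D_plus D_plus_T_0 D_plus_in_class_B
        T_0_in_class_A T_1_in_class_C T_2_in_class_B)
  show "T_L V = (T_1 \<circ> D_plus) V" if "V \<in> class_A" for V
    using that by (simp add: T_L_eq)
  show "inv_into class_A T_L f = (T_0 \<circ> T_2) f" if "f \<in> class_C" for f
  proof (rule inv_into_f_eq)
    show "inj_on T_L class_A" using bij by (rule bij_betw_imp_inj_on)
  qed (use that in \<open>simp_all add: T_L_eq T_1_T_2 D_plus_T_0 T_0_in_class_A T_2_in_class_B\<close>)
qed

end
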